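(* Let $\mathbb{K}$ be a field. Every evolution algebra $\mathcal{E}=(V,\mu)$ over $\mathbb{K}$ admits a nontrivial first-order deformation, that is, a deformation of the form $\nu_t=\mu+\nu_1 t$ which is not equivalent to $\mu$.
   Context: An evolution algebra over a field $\mathbb{K}$ is a pair $\mathcal{E}=(V,\mu)$, where $V$ is a finite-dimensional $\mathbb{K}$-vector space and $\mu\colon V\times V\to V$ is a bilinear map admitting a basis $B=\{e_1,\dots,e_n\}$ of $V$ (a natural basis) with $\mu(e_i,e_j)=0$ for all $i\neq j$. A natural basis $B$ is fixed. Let $V[[t]]$ be the $\mathbb{K}[[t]]$-module of formal power series with coefficients in $V$. $\mathbb{K}$-bilinear (resp. linear) maps on $V$ are extended $\mathbb{K}[[t]]$-bilinearly (resp. linearly) to $V[[t]]$. A deformation (formal evolution deformation) of $\mathcal{E}$ is a $\mathbb{K}[[t]]$-bilinear map $\nu_t\colon V[[t]]\times V[[t]]\to V[[t]]$ of the form $\nu_t=\mu+\sum_{k\ge1}\nu_k t^k$, with each $\nu_k\colon V\times V\to V$ a $\mathbb{K}$-bilinear map, such that $\nu_t(e_i,e_j)=0$ for all $i\ne j$. It is of order $m$ if $\nu_t=\mu+\sum_{k=1}^m\nu_kt^k$ with $\nu_m\ne0$. Two deformations $\nu_t,\lambda_t$ of $\mathcal{E}$ are equivalent if there is a $\mathbb{K}[[t]]$-linear map $\phi_t\colon V[[t]]\to V[[t]]$ of the form $\phi_t=\operatorname{Id}+t\phi_1+t^2\phi_2+\cdots$, with each $\phi_k\colon V\to V$ $\mathbb{K}$-linear,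 such that $\phi_t(\nu_t(u,v))=\lambda_t(\phi_t(u),\phi_t(v))$ for all $u,v\in V$. A deformation is trivial if it is equivalent to $\mu$ (the constant deformation).
   Formalization: The formal theorem excludes V = 0 and the case dim V = 1 with μ ≠ 0; in both, every deformation is equivalent to μ (in dimension 1 via multiplication by c(t)/a, where e·e = a e is deformed to c(t) e), so the claim is false there. *)

theory Defs
  imports "HOL-Computational_Algebra.Formal_Power_Series"
begin

unbundle fps_syntax

text \<open>
  The vector space \<open>V\<close> is the type \<open>'v\<close> with scalar multiplication \<open>scale\<close>, and
  \<open>V[[t]]\<close> is \<open>'v fps\<close>, with \<open>V\<close> embedded by \<open>fps_const\<close>.  The action of
  \<open>K[[t]] = 'k fps\<close> on it is the Cauchy product.
\<close>

definition fps_scale ::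
    "('k::field \<Rightarrow> 'v::ab_group_add \<Rightarrow> 'v) \<Rightarrow> 'k fps \<Rightarrow> 'v fps \<Rightarrow> 'v fps" where
  "fps_scale scale f x = Abs_fps (\<lambda>n. \<Sum>i=0..n. scale (f $ i) (x $ (n - i)))"

definition module_bilinear ::
    "('r::comm_ring_1 \<Rightarrow> 'm::ab_group_add \<Rightarrow> 'm) \<Rightarrow> ('m \<Rightarrow> 'm \<Rightarrow> 'm) \<Rightarrow> bool" where
  "module_bilinear s f \<longleftrightarrow>
     (\<forall>x. module_hom s s (\<lambda>y. f x y)) \<and> (\<forall>y. module_hom s s (\<lambda>x. f x y))"

locale evolution_algebra = finite_dimensional_vector_space scale B
  for scale :: "'k::field \<Rightarrow> 'v::ab_group_add \<Rightarrow> 'v"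
    and B :: "'v set"
    and \<mu> :: "'v \<Rightarrow> 'v \<Rightarrow> 'v" +
  assumes bilinear: "module_bilinear scale \<mu>"
    and natural_basis: "\<lbrakk>e \<in> B; e' \<in> B; e \<noteq> e'\<rbrakk> \<Longrightarrow> \<mu> e e' = 0"

text \<open>
  \<open>bilinear_series scale N \<nu>\<close> says that \<open>N = (\<Sum>k. \<nu> k t^k)\<close>, where each \<open>\<nu> k\<close> is bilinear over
  \<open>K\<close> and stands for its \<open>K[[t]]\<close>-bilinear extension.  As \<open>V\<close> generates \<open>V[[t]]\<close> over \<open>K[[t]]\<close>
  when it is finite-dimensional, it suffices to prescribe \<open>N\<close> on \<open>V\<close>.
  Likewise for \<open>linear_series\<close>.
\<close>

definition bilinear_series ::
    "('k::field \<Rightarrow> 'v::ab_group_add \<Rightarrow> 'v) \<Rightarrow> ('v fps \<Rightarrow> 'v fps \<Rightarrow> 'v fps)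
      \<Rightarrow> (nat \<Rightarrow> 'v \<Rightarrow> 'v \<Rightarrow> 'v) \<Rightarrow> bool" where
  "bilinear_series scale N \<nu> \<longleftrightarrow>
     module_bilinear (fps_scale scale) N \<and>
     (\<forall>k. module_bilinear scale (\<nu> k)) \<and>
     (\<forall>u v. N (fps_const u) (fps_const v) = Abs_fps (\<lambda>k. \<nu> k u v))"

definition linear_series ::
    "('k::field \<Rightarrow> 'v::ab_group_add \<Rightarrow> 'v) \<Rightarrow> ('v fps \<Rightarrow> 'v fps)
      \<Rightarrow> (nat \<Rightarrow> 'v \<Rightarrow> 'v) \<Rightarrow> bool" where
  "linear_series scale \<Phi> \<phi> \<longleftrightarrow>
     module_hom (fps_scale scale) (fps_scale scale) \<Phi> \<and>
     (\<forall>k. Vector_Spaces.linear scale scale (\<phi> k)) \<and>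
     (\<forall>v. \<Phi> (fps_const v) = Abs_fps (\<lambda>k. \<phi> k v))"

definition deformation ::
    "('k::field \<Rightarrow> 'v::ab_group_add \<Rightarrow> 'v) \<Rightarrow> 'v set \<Rightarrow> ('v \<Rightarrow> 'v \<Rightarrow> 'v)
      \<Rightarrow> ('v fps \<Rightarrow> 'v fps \<Rightarrow> 'v fps) \<Rightarrow> bool" where
  "deformation scale B \<mu> N \<longleftrightarrow>
     (\<exists>\<nu>. bilinear_series scale N \<nu> \<and> \<nu> 0 = \<mu>) \<and>
     (\<forall>e\<in>B. \<forall>e'\<in>B. e \<noteq> e' \<longrightarrow> N (fps_const e) (fps_const e') = 0)"

definition deformation_of_order ::
    "('k::field \<Rightarrow> 'v::ab_group_add \<Rightarrow> 'v) \<Rightarrow> 'v set \<Rightarrow> ('v \<Rightarrow> 'v \<Rightarrow> 'v) \<Rightarrow> nat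
      \<Rightarrow> ('v fps \<Rightarrow> 'v fps \<Rightarrow> 'v fps) \<Rightarrow> bool" where
  "deformation_of_order scale B \<mu> m N \<longleftrightarrow>
     deformation scale B \<mu> N \<and> m \<ge> 1 \<and>
     (\<exists>\<nu>. bilinear_series scale N \<nu> \<and> \<nu> 0 = \<mu> \<and>
          \<nu> m \<noteq> (\<lambda>u v. 0) \<and> (\<forall>k>m. \<nu> k = (\<lambda>u v. 0)))"

definition equivalent_deformations ::
    "('k::field \<Rightarrow> 'v::ab_group_add \<Rightarrow> 'v)
      \<Rightarrow> ('v fps \<Rightarrow> 'v fps \<Rightarrow> 'v fps) \<Rightarrow> ('v fps \<Rightarrow> 'v fps \<Rightarrow> 'v fps) \<Rightarrow> bool" where
  "equivalent_deformations scale N L \<longleftrightarrow>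
     (\<exists>\<Phi> \<phi>. linear_series scale \<Phi> \<phi> \<and> \<phi> 0 = id \<and>
        (\<forall>u v. \<Phi> (N (fps_const u) (fps_const v)) = L (\<Phi> (fps_const u)) (\<Phi> (fps_const v))))"

definition constant_extension ::
    "('v::ab_group_add \<Rightarrow> 'v \<Rightarrow> 'v) \<Rightarrow> 'v fps \<Rightarrow> 'v fps \<Rightarrow> 'v fps" where
  "constant_extension \<mu> x y = Abs_fps (\<lambda>n. \<Sum>i=0..n. \<mu> (x $ i) (y $ (n - i)))"

definition trivial_deformation ::
    "('k::field \<Rightarrow> 'v::ab_group_add \<Rightarrow> 'v) \<Rightarrow> ('v \<Rightarrow> 'v \<Rightarrow> 'v)
      \<Rightarrow> ('v fps \<Rightarrow> 'v fps \<Rightarrow> 'v fps) \<Rightarrow> bool" where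
  "trivial_deformation scale \<mu> N \<longleftrightarrow> equivalent_deformations scale N (constant_extension \<mu>)"


lemma module_fps_scale:
  assumes "vector_space scale"
  shows "module (fps_scale scale)"
proof -
  interpret vector_space scale by fact
  show ?thesis
  proof
    fix a b :: "'a fps" and x y :: "'b fps"
    show "fps_scale scale a (x + y) = fps_scale scale a x + fps_scale scale a y"
      by (simp add: fps_eq_iff fps_scale_def scale_right_distrib sum.distrib)
    show "fps_scale scale (a + b) x = fps_scale scale a x + fps_scale scale b x"
      by (simp add: fps_eq_iff fps_scale_def scale_left_distrib sum.distrib)
    show "fps_scale scale a (fps_scale scale b x) = fps_scale scale (a * b) x"
    proof (rule fps_ext)
      fix n
      have "(\<Sum>j=0..n. \<Sum>i=0..j. scale (a $ i * b $ (j - i)) (x $ (n - j))) =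
            (\<Sum>j=0..n. \<Sum>i=0..n - j. scale (a $ j * b $ i) (x $ (n - j - i)))"
        by (rule fps_mult_assoc_lemma)
      then show "fps_scale scale a (fps_scale scale b x) $ n = fps_scale scale (a * b) x $ n"
        by (simp add: fps_scale_def fps_mult_nth scale_sum_left scale_sum_right)
    qed
    have "(\<Sum>i=0..n. scale ((1 :: 'a fps) $ i) (x $ (n - i))) = x $ n" for n
      by (simp add: if_distrib[of "\<lambda>c. scale c _"] sum.delta cong: if_cong)
    then show "fps_scale scale 1 x = x"
      by (simp add: fps_eq_iff fps_scale_def)
  qed
qed

lemma deformation_constant_extension:
  assumes "evolution_algebra scale B \<mu>"
  shows "deformation scale B \<mu> (constant_extension \<mu>)"
proof -
  interpret evolution_algebra scale B \<mu> by fact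
  interpret M: module "fps_scale scale"
    by (rule module_fps_scale) unfold_locales
  have homr: "module_hom scale scale (\<lambda>y. \<mu> x y)" and homl: "module_hom scale scale (\<lambda>x. \<mu> x y)" for x y
    using bilinear by (auto simp: module_bilinear_def)
  note addr = module_hom.add[OF homr] and addl = module_hom.add[OF homl]
   and scr = module_hom.scale[OF homr] and scl = module_hom.scale[OF homl]
   and sumr = module_hom.sum[OF homr] and suml = module_hom.sum[OF homl]
   and zr = module_hom.zero[OF homr] and zl = module_hom.zero[OF homl]
  let ?E = "constant_extension \<mu>"
  have l: "?E (fps_scale scale r x) y = fps_scale scale r (?E x y)" for r x y
  proof (rule fps_ext)
    fix n
    have "(\<Sum>j=0..n. \<Sum>i=0..j. scale (r $ i) (\<mu> (x $ (j - i)) (y $ (n - j)))) =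
          (\<Sum>j=0..n. \<Sum>i=0..n - j. scale (r $ j) (\<mu> (x $ i) (y $ (n - j - i))))"
      by (rule fps_mult_assoc_lemma)
    then show "?E (fps_scale scale r x) y $ n = fps_scale scale r (?E x y) $ n"
      by (simp add: constant_extension_def fps_scale_def suml scl scale_sum_right)
  qed
  have flip: "?E x y = constant_extension (\<lambda>a b. \<mu> b a) y x" for x y
    unfolding constant_extension_def fps_eq_iff fps_nth_Abs_fps
  proof 
    fix n
    show "(\<Sum>i = 0..n. \<mu> (x $ i) (y $ (n - i))) = (\<Sum>i = 0..n. \<mu> (x $ (n - i)) (y $ i))"
      by (rule sum.reindex_bij_witness[of _ "\<lambda>i. n - i" "\<lambda>i. n - i"]) auto
  qed
  have r: "?E x (fps_scale scale r y) = fps_scale scale r (?E x y)" for r x y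
  proof (rule fps_ext)
    fix n
    have "(\<Sum>j=0..n. \<Sum>i=0..j. scale (r $ i) (\<mu> (x $ (n - j)) (y $ (j - i)))) =
          (\<Sum>j=0..n. \<Sum>i=0..n - j. scale (r $ j) (\<mu> (x $ (n - j - i)) (y $ i)))"
      by (rule fps_mult_assoc_lemma)
    then show "?E x (fps_scale scale r y) $ n = fps_scale scale r (?E x y) $ n"
      unfolding flip
      by (simp add: constant_extension_def fps_scale_def sumr scr scale_sum_right)
  qed
  have "module_bilinear (fps_scale scale) ?E"
    unfolding module_bilinear_def module_hom_def module_hom_axioms_def
    using M.module_axioms l r
    by (auto simp: constant_extension_def fps_eq_iff addl addr sum.distrib)
  moreover
  have "?E (fps_const u) (fps_const v) = Abs_fps (\<lambda>k. (if k = 0 then \<mu> else (\<lambda>u v. 0)) u v)" for u v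
  proof (rule fps_ext)
    fix n
    have "(\<Sum>i=0..n. \<mu> (fps_const u $ i) (fps_const v $ (n - i))) =
      (\<Sum>i=0..n. if i = 0 then \<mu> u (fps_const v $ n) else 0)"
      by (rule sum.cong) (auto simp: zl)
    then show "?E (fps_const u) (fps_const v) $ n =
        Abs_fps (\<lambda>k. (if k = 0 then \<mu> else (\<lambda>u v. 0)) u v) $ n"
      by (simp add: constant_extension_def zr)
  qed
  moreover have "module_bilinear scale (if k = 0 then \<mu> else (\<lambda>u v. 0))" for k :: nat
    using bilinear module_axioms
    by (auto simp: module_bilinear_def module_hom_def module_hom_axioms_def)
  ultimately have "bilinear_series scale ?E (\<lambda>k. if k = 0 then \<mu> else (\<lambda>u v. 0))"
    unfolding bilinear_series_def by blast
  moreover have "?E (fps_const e) (fps_const e') = 0" if "e \<in> B" "e' \<in> B" "e \<noteq> e'" for e e'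
    using calculation natural_basis[OF that] by (simp add: bilinear_series_def fps_eq_iff)
  ultimately show ?thesis
    unfolding deformation_def by auto
qed

text \<open>
  In dimension 0, and in dimension 1 with \<open>\<mu> \<noteq> 0\<close>, no nontrivial deformation exists:
  if \<open>\<mu> e e = a e\<close> with \<open>a \<noteq> 0\<close> and \<open>\<nu>\<^sub>t e e = c(t) e\<close>, then multiplication by
  \<open>c(t) / a\<close> is an equivalence.  So these cases have to be excluded in any existence statement.
\<close>

lemma trivial_deformation_dim_0:
  assumes "evolution_algebra scale {} \<mu>" "deformation scale {} \<mu> N"
  shows "trivial_deformation scale \<mu> N"
proof -
  interpret evolution_algebra scale "{}" \<mu> by fact
  have z: "x = 0" for x :: 'b
    using span_Basis span_empty by (metis UNIV_I singletonD)
  have fz: "x = 0" for x :: "'b fps"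
    by (rule fps_ext) (use z in auto)
  have "linear_series scale id (\<lambda>k. id)"
    unfolding linear_series_def module_hom_iff_linear[symmetric] module_hom_def module_hom_axioms_def
    using module_fps_scale[OF vector_space_axioms] module_axioms
    by (auto intro: fz[THEN trans, OF fz[symmetric]])
  then show ?thesis
    unfolding trivial_deformation_def equivalent_deformations_def using fz by metis
qed

lemma trivial_deformation_dim_1:
  assumes "evolution_algebra scale B \<mu>" "card B = 1" "\<mu> \<noteq> (\<lambda>u v. 0)" "deformation scale B \<mu> N"
  shows "trivial_deformation scale \<mu> N"
proof -
  interpret evolution_algebra scale B \<mu> by fact
  interpret M: module "fps_scale scale"
    by (rule module_fps_scale) unfold_locales
  obtain e where B: "B = {e}"
    using \<open>card B = 1\<close> card_1_singletonE by blast
  have "\<exists>c. x = scale c e" for x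
    using span_Basis by (auto simp: B span_singleton)
  then obtain p where p: "x = scale (p x) e" for x by metis
  have bil: "f (scale x u) (scale y v) = scale (x * y) (f u v)"
    if "module_bilinear scale f" for f x y u v
  proof -
    have "module_hom scale scale (\<lambda>x. f x (scale y v))" "module_hom scale scale (f u)"
      using that by (simp_all add: module_bilinear_def)
    then show ?thesis
      by (simp add: module_hom.scale[of _ _ "\<lambda>x. f x (scale y v)"] module_hom.scale[of _ _ "f u"])
  qed
  define a where "a = p (\<mu> e e)"
  have a: "\<mu> e e = scale a e" unfolding a_def by (rule p)
  have "a \<noteq> 0"
  proof
    assume "a = 0"
    then have "\<mu> u v = 0" for u v
      using bil[OF bilinear, of "p u" e "p v" e] p[of u, symmetric] p[of v, symmetric] a by simp
    then have "\<mu> = (\<lambda>u v. 0)" by (intro ext)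
    then show False using assms(3) by contradiction
  qed
  obtain \<nu> where \<nu>: "\<nu> 0 = \<mu>" "\<And>k. module_bilinear scale (\<nu> k)"
      "\<And>u v. N (fps_const u) (fps_const v) = Abs_fps (\<lambda>k. \<nu> k u v)"
    using assms(4) by (auto simp: deformation_def bilinear_series_def)
  define c where "c = (\<lambda>k. p (\<nu> k e e))"
  have c: "\<nu> k e e = scale (c k) e" for k unfolding c_def by (rule p)
  define f where "f = Abs_fps (\<lambda>k. c k / a)"
  have "c 0 = a" using \<nu>(1) by (simp add: c_def a_def)
  have ser: "linear_series scale (fps_scale scale f) (\<lambda>k. scale (f $ k))"
    unfolding linear_series_def
  proof (intro conjI allI)
    show "module_hom (fps_scale scale) (fps_scale scale) (fps_scale scale f)"
      by unfold_locales (simp_all add: M.scale_right_distrib mult.commute)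
    show "Vector_Spaces.linear scale scale (scale (f $ k))" for k
      by (simp add: linear_scale_self)
    show "fps_scale scale f (fps_const v) = Abs_fps (\<lambda>k. scale (f $ k) v)" for v
    proof (rule fps_ext)
      fix n
      have "(\<Sum>i=0..n. scale (f $ i) (fps_const v $ (n - i))) = (\<Sum>i=0..n. if i = n then scale (f $ n) v else 0)"
        by (rule sum.cong) auto
      then show "fps_scale scale f (fps_const v) $ n = Abs_fps (\<lambda>k. scale (f $ k) v) $ n"
        by (simp add: fps_scale_def)
    qed
  qed
  have "fps_scale scale f (N (fps_const u) (fps_const v)) =
      constant_extension \<mu> (fps_scale scale f (fps_const u)) (fps_scale scale f (fps_const v))" for u v
  proof (rule fps_ext)
    fix n
    have m: "\<mu> u v = scale (p u * p v * a) e"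
      using bil[OF bilinear, of "p u" e "p v" e] p[of u, symmetric] p[of v, symmetric] a by simp
    have n: "\<nu> k u v = scale (p u * p v * c k) e" for k
      using bil[OF \<nu>(2), of k "p u" e "p v" e] p[of u, symmetric] p[of v, symmetric] c by simp
    have F: "fps_scale scale f (fps_const w) $ k = scale (f $ k) w" for w k
      using ser by (simp add: linear_series_def)
    have G: "fps_scale scale f (N (fps_const u) (fps_const v)) $ n =
        (\<Sum>i=0..n. scale (f $ i) (scale (p u * p v * c (n - i)) e))"
      by (simp add: fps_scale_def \<nu>(3) n)
    show "fps_scale scale f (N (fps_const u) (fps_const v)) $ n =
      constant_extension \<mu> (fps_scale scale f (fps_const u)) (fps_scale scale f (fps_const v)) $ n"
      unfolding constant_extension_def fps_nth_Abs_fps F bil[OF bilinear] m G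
      using \<open>a \<noteq> 0\<close> by (intro sum.cong) (auto simp: f_def field_simps)
  qed
  moreover have "scale (f $ 0) = id"
    using \<open>c 0 = a\<close> \<open>a \<noteq> 0\<close> by (auto simp: f_def)
  ultimately show ?thesis
    unfolding trivial_deformation_def equivalent_deformations_def using ser by blast
qed

end

theory Submission
  imports Defs
begin

text \<open>
  If \<open>\<mu> + \<nu> t\<close> is equivalent to \<open>\<mu>\<close> via \<open>\<phi>\<^sub>t = Id + t \<phi> + \<dots>\<close>, then the coefficient of \<open>t\<close> shows
  that \<open>\<nu>\<close> is the coboundary \<open>\<mu> (\<phi> u) v + \<mu> u (\<phi> v) - \<phi> (\<mu> u v)\<close>.  So it suffices to find a
  diagonal \<open>\<nu>\<close>, given by arbitrary values \<open>w e = \<nu> e e\<close> on the natural basis, that is not a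
  coboundary.  Suppose that all of them are.  Then no \<open>\<mu> e e\<close> vanishes and no two of
  them are proportional; hence every such \<open>\<phi>\<close> is diagonal, with entries \<open>d\<^sub>e\<close> say, and the
  equations \<open>(2 d\<^sub>e - d\<^sub>k) (\<mu> e e)\<^sub>k = (w e)\<^sub>k\<close> for \<open>e, k\<close> in a pair of basis vectors
  cannot be solved for every \<open>w\<close>.
\<close>

lemma fps_scale_X_nth:
  assumes "vector_space scale"
  shows "fps_scale scale fps_X x $ n = (if n = 0 then 0 else x $ (n - 1))"
proof -
  interpret vector_space scale by fact
  have "(\<Sum>i=0..n. scale (fps_X $ i) (x $ (n - i))) = (\<Sum>i=0..n. if i = 1 then x $ (n - 1) else 0)"
    by (rule sum.cong) auto
  then show ?thesis
    by (auto simp: fps_scale_def)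
qed

context evolution_algebra
begin

section \<open>Coordinates with respect to the natural basis\<close>

abbreviation coord :: "'v \<Rightarrow> 'v \<Rightarrow> 'k" where
  "coord e x \<equiv> representation B x e"

lemma coord_add: "coord e (x + y) = coord e x + coord e y"
  by (simp add: representation_add independent_Basis span_Basis)

lemma coord_diff: "coord e (x - y) = coord e x - coord e y"
  by (simp add: representation_diff independent_Basis span_Basis)

lemma coord_scale: "coord e (scale c x) = c * coord e x"
  by (simp add: representation_scale independent_Basis span_Basis)

lemma coord_Basis: "e \<in> B \<Longrightarrow> coord f e = (if f = e then 1 else 0)"
  by (simp add: representation_basis independent_Basis)

lemma sum_coord: "(\<Sum>e\<in>B. scale (coord e x) e) = x"
  by (rule sum_representation_eq)
     (use finite_Basis independent_Basis span_Basis in auto)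

lemma mu_hom: "module_hom scale scale (\<lambda>y. \<mu> x y)" "module_hom scale scale (\<lambda>x. \<mu> x y)"
  using bilinear by (auto simp: module_bilinear_def)

lemma mu_zero: "\<mu> 0 y = 0" "\<mu> x 0 = 0"
  using module_hom.zero[OF mu_hom(1)] module_hom.zero[OF mu_hom(2)] by auto

text \<open>Expanding \<open>x\<close> in \<open>B\<close>, the vanishing of products of distinct
  basis vectors kills every term but one. Hence each product in a coboundary on basis vectors
  involves a single entry of \<open>\<phi>\<close>.\<close>

lemma mu_Basis_right:
  assumes "e \<in> B"
  shows "\<mu> x e = scale (coord e x) (\<mu> e e)"
proof -
  have "\<mu> x e = (\<Sum>f\<in>B. scale (coord f x) (\<mu> f e))"
    by (subst (1) sum_coord[of x, symmetric])
       (simp add: module_hom.sum[OF mu_hom(2)] module_hom.scale[OF mu_hom(2)])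
  also have "\<dots> = (\<Sum>f\<in>B. if f = e then scale (coord e x) (\<mu> e e) else 0)"
    by (rule sum.cong) (auto simp: natural_basis assms)
  finally show ?thesis
    using assms finite_Basis by simp
qed

lemma mu_Basis_left:
  assumes "e \<in> B"
  shows "\<mu> e x = scale (coord e x) (\<mu> e e)"
proof -
  have "\<mu> e x = (\<Sum>f\<in>B. scale (coord f x) (\<mu> e f))"
    by (subst (1) sum_coord[of x, symmetric])
       (simp add: module_hom.sum[OF mu_hom(1)] module_hom.scale[OF mu_hom(1)])
  also have "\<dots> = (\<Sum>f\<in>B. if f = e then scale (coord e x) (\<mu> e e) else 0)"
    by (rule sum.cong) (auto simp: natural_basis assms)
  finally show ?thesis
    using assms finite_Basis by simp
qed

section \<open>Coboundaries: the failure of a linear map to be a derivation of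
  \<open>\<mu>\<close>\<close>

definition coboundary :: "('v \<Rightarrow> 'v) \<Rightarrow> 'v \<Rightarrow> 'v \<Rightarrow> 'v" where
  "coboundary \<phi> u v = \<mu> (\<phi> u) v + \<mu> u (\<phi> v) - \<phi> (\<mu> u v)"

text \<open>Testing on pairs of basis vectors is enough, as they determine a bilinear map. The zeros
  off the diagonal mirror the condition imposed on deformations.\<close>

definition diagonal_coboundary :: "('v \<Rightarrow> 'v) \<Rightarrow> ('v \<Rightarrow> 'v) \<Rightarrow> bool" where
  "diagonal_coboundary w \<phi> \<longleftrightarrow> Vector_Spaces.linear scale scale \<phi> \<and>
     (\<forall>e\<in>B. \<forall>f\<in>B. coboundary \<phi> e f = (if e = f then w e else 0))"

lemma diagonal_coboundary_same:
  assumes "diagonal_coboundary w \<phi>" "e \<in> B"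
  shows "scale (2 * coord e (\<phi> e)) (\<mu> e e) - \<phi> (\<mu> e e) = w e"
proof -
  have "coboundary \<phi> e e = w e"
    using assms by (simp add: diagonal_coboundary_def)
  then show ?thesis
    unfolding coboundary_def mu_Basis_left[OF assms(2), of "\<phi> e"]
      mu_Basis_right[OF assms(2), of "\<phi> e"] mult_2 scale_left_distrib .
qed

text \<open>The term \<open>\<phi> (\<mu> e f)\<close> drops out because
  \<open>\<mu> e f = 0\<close>. What remains is a linear relation between two squares, which will
  force the off-diagonal entries of \<open>\<phi>\<close> to vanish once squares are known not to be
  proportional.\<close>

lemma diagonal_coboundary_different:
  assumes "diagonal_coboundary w \<phi>" "e \<in> B" "f \<in> B" "e \<noteq> f"
  shows "scale (coord f (\<phi> e)) (\<mu> f f) + scale (coord e (\<phi> f)) (\<mu> e e) = 0"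
proof -
  have "module_hom scale scale \<phi>"
    using assms(1) by (simp add: diagonal_coboundary_def module_hom_iff_linear)
  then have "\<phi> 0 = 0"
    by (rule module_hom.zero)
  moreover have "coboundary \<phi> e f = 0"
    using assms by (simp add: diagonal_coboundary_def)
  ultimately show ?thesis
    by (simp add: coboundary_def natural_basis[OF assms(2-4)] mu_Basis_left[OF assms(2), of "\<phi> f"]
        mu_Basis_right[OF assms(3), of "\<phi> e"])
qed

lemma diagonal_coboundary_zero: "diagonal_coboundary (\<lambda>e. 0) (\<lambda>x. 0)"
  using module_axioms
  by (simp add: diagonal_coboundary_def coboundary_def mu_zero module_hom_def module_hom_axioms_def
      flip: module_hom_iff_linear)

section \<open>Diagonal values that no coboundary attains\<close>

lemma ex_not_diagonal_coboundary:
  assumes "B \<noteq> {}" and "card B = 1 \<Longrightarrow> \<mu> = (\<lambda>u v. 0)"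
  shows "\<exists>w. \<forall>\<phi>. \<not> diagonal_coboundary w \<phi>"
proof (rule ccontr)
  assume "\<not> ?thesis"
  then have ex: "\<exists>\<phi>. diagonal_coboundary w \<phi>" for w by auto
  have nz: "e \<noteq> 0" if "e \<in> B" for e
    using coord_Basis[OF that, of e] by (auto simp: representation_zero)
  have lin: "\<phi> (scale c x) = scale c (\<phi> x)" "\<phi> 0 = 0" if "diagonal_coboundary w \<phi>" for w \<phi> c x
    using that by (auto simp: diagonal_coboundary_def module_hom_iff_linear[symmetric]
        module_hom.scale module_hom.zero)
  have sq: "\<mu> e e \<noteq> 0" if e: "e \<in> B" for e
  proof
    assume "\<mu> e e = 0"
    \<comment> \<open>With a vanishing square both terms of the coboundary at \<open>(e, e)\<close>
      are 0, so any prescribed value that is nonzero at \<open>e\<close> gives a contradiction; the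
      constant \<open>e\<close> is one.\<close>
    moreover obtain \<phi> where \<phi>: "diagonal_coboundary (\<lambda>_. e) \<phi>" using ex by blast
    ultimately show False
      using diagonal_coboundary_same[OF \<phi> e] nz[OF e] lin(2)[OF \<phi>] by simp
  qed
  obtain e where e: "e \<in> B" using assms by blast
  obtain f where f: "f \<in> B" "f \<noteq> e"
  proof -
    \<comment> \<open>In dimension 1 the hypothesis makes \<open>\<mu>\<close> zero, against
      \<open>sq\<close>; this settles that case and leaves a second basis vector.\<close>
    have "card B \<noteq> 1" using assms(2) sq[OF e] by auto
    then have "B \<noteq> {e}" by auto
    then show thesis using that e by blast
  qed
  have indep: "\<mu> a a \<noteq> scale c (\<mu> b b)" if ab: "a \<in> B" "b \<in> B" "a \<noteq> b" for a b c
  proof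
    assume eq: "\<mu> a a = scale c (\<mu> b b)"
    \<comment> \<open>A line cannot contain both \<open>a\<close> and \<open>b\<close>, so some
      \<open>x\<close> lies off the line through \<open>\<mu> a a\<close>. It is prescribed at
      \<open>a\<close>, with 0 elsewhere: the equation at \<open>b\<close> makes
      \<open>\<mu> b b\<close> an eigenvector of \<open>\<phi>\<close>, hence also its multiple
      \<open>\<mu> a a\<close>, and then the equation at \<open>a\<close> puts \<open>x\<close> on
      that line after all.\<close>
    have "\<exists>x. \<forall>k. x \<noteq> scale k (\<mu> a a)"
    proof (rule ccontr)
      assume "\<not> ?thesis"
      then obtain k l where kl: "a = scale k (\<mu> a a)" "b = scale l (\<mu> a a)" by metis
      have "coord a b = 0" "coord a a = 1" "coord b b = 1"
        using ab by (auto simp: coord_Basis)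
      moreover have "coord a b = l * coord a (\<mu> a a)" "coord a a = k * coord a (\<mu> a a)"
          "coord b b = l * coord b (\<mu> a a)"
        using arg_cong[OF kl(1), of "coord a"] arg_cong[OF kl(2), of "coord a"]
          arg_cong[OF kl(2), of "coord b"] by (simp_all only: coord_scale)
      ultimately show False
        by auto
    qed
    then obtain x where x: "\<And>k. x \<noteq> scale k (\<mu> a a)" by blast
    obtain \<phi> where \<phi>: "diagonal_coboundary (\<lambda>g. if g = a then x else 0) \<phi>" using ex by blast
    have "scale (2 * coord a (\<phi> a)) (\<mu> a a) - \<phi> (\<mu> a a) = x"
      using diagonal_coboundary_same[OF \<phi> ab(1)] by simp
    moreover have "\<phi> (\<mu> b b) = scale (2 * coord b (\<phi> b)) (\<mu> b b)"
      using diagonal_coboundary_same[OF \<phi> ab(2)] ab(3) by simp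
    then have "\<phi> (\<mu> a a) = scale (2 * coord b (\<phi> b)) (\<mu> a a)"
      by (simp add: eq lin[OF \<phi>] mult.commute)
    ultimately have "x = scale (2 * coord a (\<phi> a) - 2 * coord b (\<phi> b)) (\<mu> a a)"
      by (simp add: scale_left_diff_distrib)
    then show False using x by blast
  qed
  have diag: "\<phi> a = scale (coord a (\<phi> a)) a" if \<phi>: "diagonal_coboundary w \<phi>" and a: "a \<in> B" for w \<phi> a
  proof -
    have off: "coord b (\<phi> a) = 0" if b: "b \<in> B" "b \<noteq> a" for b
    proof (rule ccontr)
      assume nz: "coord b (\<phi> a) \<noteq> 0"
      \<comment> \<open>Dividing this relation by the supposedly nonzero entry makes
        \<open>\<mu> b b\<close> a multiple of \<open>\<mu> a a\<close>, which \<open>indep\<close>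
        rules out.\<close>
      have "scale (coord b (\<phi> a)) (\<mu> b b) = scale (- coord a (\<phi> b)) (\<mu> a a)"
        using diagonal_coboundary_different[OF \<phi> a b(1)] b(2) by (simp add: eq_neg_iff_add_eq_0)
      then have "scale (inverse (coord b (\<phi> a))) (scale (coord b (\<phi> a)) (\<mu> b b)) =
         scale (inverse (coord b (\<phi> a))) (scale (- coord a (\<phi> b)) (\<mu> a a))" by simp
      then show False using indep[OF b(1) a b(2)] nz by (auto simp del: scale_minus_left)
    qed
    have "\<phi> a = (\<Sum>b\<in>B. scale (coord b (\<phi> a)) b)" by (rule sum_coord[symmetric])
    also have "\<dots> = (\<Sum>b\<in>B. if b = a then scale (coord a (\<phi> a)) a else 0)"
      by (rule sum.cong) (auto simp: off)
    finally show ?thesis using a finite_Basis by simp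
  qed
  have coords: "(2 * coord a (\<phi> a) - coord b (\<phi> b)) * coord b (\<mu> a a) = coord b (w a)"
    if \<phi>: "diagonal_coboundary w \<phi>" and ab: "a \<in> B" "b \<in> B" for w \<phi> a b
  proof -
    have hom: "module_hom scale scale \<phi>"
      using \<phi> by (simp add: diagonal_coboundary_def module_hom_iff_linear)
    \<comment> \<open>By \<open>diag\<close>, the basis vectors are eigenvectors of
      \<open>\<phi>\<close>, so different coordinates do not mix.\<close>
    have "coord b (\<phi> x) = coord b (\<phi> b) * coord b x" for x
    proof -
      have "\<phi> x = (\<Sum>c\<in>B. scale (coord c x) (\<phi> c))"
        by (subst (1) sum_coord[of x, symmetric])
           (simp add: module_hom.sum[OF hom] module_hom.scale[OF hom])
      also have "\<dots> = (\<Sum>c\<in>B. scale (coord c x * coord c (\<phi> c)) c)"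
        by (rule sum.cong) (rule refl, metis diag[OF \<phi>] scale_scale)
      finally have "coord b (\<phi> x) = (\<Sum>c\<in>B. coord b (scale (coord c x * coord c (\<phi> c)) c))"
        by (simp add: representation_sum independent_Basis span_Basis)
      also have "\<dots> = (\<Sum>c\<in>B. if c = b then coord b (\<phi> b) * coord b x else 0)"
        by (rule sum.cong) (auto simp: coord_scale coord_Basis)
      also have "\<dots> = coord b (\<phi> b) * coord b x"
        using ab(2) finite_Basis by simp
      finally show ?thesis .
    qed
    from this[of "\<mu> a a"] show ?thesis
      using arg_cong[OF diagonal_coboundary_same[OF \<phi> ab(1)], of "coord b"]
      by (simp add: coord_diff coord_scale left_diff_distrib)
  qed
  have nonzero: "coord b (\<mu> a a) \<noteq> 0" if "a \<in> B" "b \<in> B" for a b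
  proof
    assume z: "coord b (\<mu> a a) = 0"
    \<comment> \<open>The value \<open>b\<close> makes the right-hand side of \<open>coords\<close>
      equal to 1, while the left-hand side has the factor
      \<open>coord b (\<mu> a a)\<close>.\<close>
    obtain \<phi> where "diagonal_coboundary (\<lambda>_. b) \<phi>" using ex by blast
    from coords[OF this that] z show False by (simp add: coord_Basis that)
  qed
  \<comment> \<open>The value \<open>f\<close> at \<open>e\<close> has coordinate 0 at
    \<open>e\<close> and 1 at \<open>f\<close>. The equations at \<open>(e, e)\<close> and
    \<open>(f, f)\<close> are thus homogeneous; since \<open>2 d - d = d\<close> in every
    characteristic, they make both diagonal entries 0. The equation at \<open>(e, f)\<close> then
    reads \<open>0 = 1\<close>.\<close>
  obtain \<phi> where \<phi>: "diagonal_coboundary (\<lambda>a. if a = e then f else 0) \<phi>" using ex by blast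
  have "coord e (\<phi> e) * coord e (\<mu> e e) = 0"
    using coords[OF \<phi> e e] f by (simp add: coord_Basis)
  moreover have "coord f (\<phi> f) * coord f (\<mu> f f) = 0"
    using coords[OF \<phi> f(1) f(1)] f(2) by (simp add: representation_zero)
  ultimately have "coord e (\<phi> e) = 0" "coord f (\<phi> f) = 0"
    using nonzero e f(1) by auto
  then have "coord f f = 0"
    using coords[OF \<phi> e f(1)] by simp
  then show False
    by (simp add: coord_Basis f(1))
qed

section \<open>First-order deformations with a diagonal linear term\<close>

lemma constant_extension_const:
  "constant_extension \<mu> (fps_const u) (fps_const v) = fps_const (\<mu> u v)"
proof (rule fps_ext)
  fix n
  have "(\<Sum>i=0..n. \<mu> (fps_const u $ i) (fps_const v $ (n - i))) =
      (\<Sum>i=0..n. if i = 0 then \<mu> u (fps_const v $ n) else 0)"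
    by (rule sum.cong) (auto simp: mu_zero)
  then show "constant_extension \<mu> (fps_const u) (fps_const v) $ n = fps_const (\<mu> u v) $ n"
    by (simp add: constant_extension_def mu_zero)
qed

lemma module_bilinear_constant_extension:
  "module_bilinear (fps_scale scale) (constant_extension \<mu>)"
  using deformation_constant_extension[OF evolution_algebra_axioms]
  by (auto simp: deformation_def bilinear_series_def)

definition diagonal_map :: "('v \<Rightarrow> 'v) \<Rightarrow> 'v \<Rightarrow> 'v \<Rightarrow> 'v" where
  "diagonal_map w u v = (\<Sum>e\<in>B. scale (coord e u * coord e v) (w e))"

lemma diagonal_map_Basis:
  assumes "e \<in> B" "f \<in> B"
  shows "diagonal_map w e f = (if e = f then w e else 0)"
proof -
  have "diagonal_map w e f = (\<Sum>g\<in>B. if g = e then if e = f then w e else 0 else 0)"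
    unfolding diagonal_map_def by (rule sum.cong) (auto simp: coord_Basis assms)
  then show ?thesis
    using assms finite_Basis by simp
qed

text \<open>Viewing the linear term as an evolution product with the same natural basis lets the
  facts about \<open>constant_extension \<mu>\<close> be reused for it.\<close>

lemma evolution_algebra_diagonal_map: "evolution_algebra scale B (diagonal_map w)"
proof
  show "module_bilinear scale (diagonal_map w)"
    unfolding module_bilinear_def module_hom_def module_hom_axioms_def
    using module_axioms
    by (simp add: diagonal_map_def coord_add coord_scale algebra_simps sum.distrib scale_sum_right
        scale_left_distrib)
qed (simp add: diagonal_map_Basis)

definition first_order_extension :: "('v \<Rightarrow> 'v \<Rightarrow> 'v) \<Rightarrow> 'v fps \<Rightarrow> 'v fps \<Rightarrow> 'v fps" where
  "first_order_extension \<nu> x y =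
     constant_extension \<mu> x y + fps_scale scale fps_X (constant_extension \<nu> x y)"

lemma first_order_extension_const:
  assumes "evolution_algebra scale B \<nu>"
  shows "first_order_extension \<nu> (fps_const u) (fps_const v) =
    fps_const (\<mu> u v) + fps_scale scale fps_X (fps_const (\<nu> u v))"
  by (simp add: first_order_extension_def constant_extension_const
      evolution_algebra.constant_extension_const[OF assms])

lemma deformation_of_order_first_order_extension:
  assumes \<nu>: "evolution_algebra scale B \<nu>" and nz: "\<nu> \<noteq> (\<lambda>u v. 0)"
  shows "deformation_of_order scale B \<mu> 1 (first_order_extension \<nu>)"
proof -
  interpret M: module "fps_scale scale"
    by (rule module_fps_scale) unfold_locales
  let ?s = "\<lambda>k::nat. if k = 0 then \<mu> else if k = 1 then \<nu> else (\<lambda>u v. 0)"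
  have \<nu>bil: "module_bilinear scale \<nu>"
    using \<nu> by (simp add: evolution_algebra_def evolution_algebra_axioms_def)
  have "module_bilinear (fps_scale scale) (first_order_extension \<nu>)"
    using module_bilinear_constant_extension
      evolution_algebra.module_bilinear_constant_extension[OF \<nu>]
    by (simp add: module_bilinear_def module_hom_def module_hom_axioms_def
        first_order_extension_def M.scale_right_distrib mult.commute add_ac)
  moreover have "module_bilinear scale (?s k)" for k
    using bilinear \<nu>bil module_axioms
    by (auto simp: module_bilinear_def module_hom_def module_hom_axioms_def)
  moreover have "first_order_extension \<nu> (fps_const u) (fps_const v) = Abs_fps (\<lambda>k. ?s k u v)" for u v
    by (auto simp: first_order_extension_const[OF \<nu>] fps_eq_iff fps_scale_X_nth[OF vector_space_axioms])
  ultimately have "bilinear_series scale (first_order_extension \<nu>) ?s"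
    unfolding bilinear_series_def by blast
  moreover have "first_order_extension \<nu> (fps_const e) (fps_const f) = 0"
    if "e \<in> B" "f \<in> B" "e \<noteq> f" for e f
    by (simp add: first_order_extension_const[OF \<nu>] natural_basis[OF that]
        evolution_algebra.natural_basis[OF \<nu> that])
  ultimately show ?thesis
    unfolding deformation_of_order_def deformation_def using nz
    by (intro conjI ballI impI exI[of _ ?s]) auto
qed

text \<open>This is the infinitesimal form of an equivalence with \<open>\<mu>\<close>: its linear
  part \<open>\<phi> 1\<close> exhibits \<open>\<nu>\<close> as a coboundary.\<close>

lemma trivial_first_order_extension_coboundary:
  assumes \<nu>: "evolution_algebra scale B \<nu>"
    and "trivial_deformation scale \<mu> (first_order_extension \<nu>)"
  obtains \<phi> where "Vector_Spaces.linear scale scale \<phi>" "\<nu> = coboundary \<phi>"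
proof -
  interpret M: module "fps_scale scale"
    by (rule module_fps_scale) unfold_locales
  obtain \<Phi> \<phi> where ser: "linear_series scale \<Phi> \<phi>" and id: "\<phi> 0 = id"
    and eq: "\<And>u v. \<Phi> (first_order_extension \<nu> (fps_const u) (fps_const v)) =
        constant_extension \<mu> (\<Phi> (fps_const u)) (\<Phi> (fps_const v))"
    using assms(2) unfolding trivial_deformation_def equivalent_deformations_def by blast
  have \<Phi>: "module_hom (fps_scale scale) (fps_scale scale) \<Phi>"
    and \<phi>: "\<And>k. Vector_Spaces.linear scale scale (\<phi> k)"
    and nth: "\<And>v. \<Phi> (fps_const v) = Abs_fps (\<lambda>k. \<phi> k v)"
    using ser by (auto simp: linear_series_def)
  have "\<nu> u v = coboundary (\<phi> 1) u v" for u v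
  proof -
    \<comment> \<open>Comparison of the coefficients of \<open>t\<close>. On the left,
      \<open>\<Phi>\<close> applied to \<open>t \<nu> u v\<close> contributes
      \<open>\<phi> 0 (\<nu> u v)\<close>, which is \<open>\<nu> u v\<close>; on the right, the
      Cauchy product has two terms, each with one factor \<open>\<phi> 0 = id\<close>.\<close>
    have "\<phi> 1 (\<mu> u v) + \<nu> u v = \<mu> u (\<phi> 1 v) + \<mu> (\<phi> 1 u) v"
      using arg_cong[OF eq[of u v], of "\<lambda>x. x $ 1"]
      by (simp add: first_order_extension_const[OF \<nu>] module_hom.add[OF \<Phi>] module_hom.scale[OF \<Phi>]
          nth id fps_scale_X_nth[OF vector_space_axioms] constant_extension_def)
    then show ?thesis
      by (simp add: coboundary_def eq_diff_eq add.commute)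
  qed
  then show thesis
    using that[of "\<phi> 1"] \<phi> by blast
qed

end

text \<open>The cases set aside are those in which \<open>trivial_deformation_dim_0\<close> and
  \<open>trivial_deformation_dim_1\<close> show every deformation to be trivial.\<close>

theorem theorem3p14:
  fixes scale :: "'k::field \<Rightarrow> 'v::ab_group_add \<Rightarrow> 'v"
    and B :: "'v set"
    and \<mu> :: "'v \<Rightarrow> 'v \<Rightarrow> 'v"
  assumes "evolution_algebra scale B \<mu>"
    and "B \<noteq> {}"
    and "card B = 1 \<Longrightarrow> \<mu> = (\<lambda>u v. 0)"
  shows "\<exists>N. deformation_of_order scale B \<mu> 1 N \<and> \<not> trivial_deformation scale \<mu> N"
proof -
  interpret evolution_algebra scale B \<mu> by fact
  obtain w where w: "\<And>\<phi>. \<not> diagonal_coboundary w \<phi>"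
    using ex_not_diagonal_coboundary assms(2,3) by blast
  let ?\<nu> = "diagonal_map w"
  have not_cob: "?\<nu> \<noteq> coboundary \<phi>" if "Vector_Spaces.linear scale scale \<phi>" for \<phi>
  proof
    assume "?\<nu> = coboundary \<phi>"
    then have "diagonal_coboundary w \<phi>"
      using that by (auto simp: diagonal_coboundary_def diagonal_map_Basis simp flip: \<open>?\<nu> = coboundary \<phi>\<close>)
    then show False using w by blast
  qed
  \<comment> \<open>The zero map is the coboundary of 0, so a non-coboundary is nonzero; this makes
    the order exactly 1.\<close>
  have "?\<nu> \<noteq> (\<lambda>u v. 0)"
    using not_cob[of "\<lambda>x. 0"] diagonal_coboundary_zero
    by (auto simp: diagonal_coboundary_def coboundary_def[abs_def] mu_zero)
  then have "deformation_of_order scale B \<mu> 1 (first_order_extension ?\<nu>)"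
    by (intro deformation_of_order_first_order_extension evolution_algebra_diagonal_map)
  moreover have "\<not> trivial_deformation scale \<mu> (first_order_extension ?\<nu>)"
    using trivial_first_order_extension_coboundary[OF evolution_algebra_diagonal_map] not_cob
    by metis
  ultimately show ?thesis by blast
qed

end
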